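(* Let $M$ be a tame matroid. Then the following are equivalent: (1) $M$ is orthogonally orientable; (2) every finite minor of $M$ is orthogonally orientable (i.e. is the underlying matroid of a finite oriented matroid).
   Context: Matroids are matroids in the sense of Bruhn, Diestel, Kriesell, Pendavingh and Wollan, on a possibly infinite ground set; a matroid is tame if every intersection of a circuit with a cocircuit is finite. A signed subset $X$ of $E$ is a subset $\underline{X}\subseteq E$ with a partition $(X^+,X^-)$; $X(e)=\pm1$ according as $e\in X^\pm$; $-X$ swaps $X^+$ and $X^-$. Two signed subsets $X,Y$ are orthogonal if $\underline{X}\cap\underline{Y}=\emptyset$ or there are $e,f\in\underline{X}\cap\underline{Y}$ with $X(e)Y(e)=-X(f)Y(f)$. A circuit signature of $M$ is a set of signed subsets consisting of exactly two opposite signed subsets supported by each circuit of $M$; a cocircuit signature is a circuit signature of the dual $M^*$. $M$ is orthogonally orientable if there exist a circuit signature $\mathcal{C}$ and a cocircuit signature $\mathcal{C}^*$ of $M$ such that every element of $\mathcal{C}$ is orthogonal to every element of $\mathcal{C}^*$. For finite $M$ this is exactly the notion of being the underlying matroid of an oriented matroid. *)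

theory Defs
  imports Main
begin

text \<open>Possibly infinite matroids in the sense of Bruhn, Diestel, Kriesell, Pendavingh and
  Wollan, given by the independence axioms (I1), (I2), (I3) and (IM). The record type itself
  carries no axioms, so that duals and minors can be formed without proof obligations.\<close>

record 'a set_system =
  ground :: "'a set"
  indeps :: "'a set set"

definition maximal_in :: "'a set set \<Rightarrow> 'a set \<Rightarrow> bool" where
  "maximal_in F B \<longleftrightarrow> B \<in> F \<and> (\<forall>I\<in>F. B \<subseteq> I \<longrightarrow> I = B)"

definition base :: "'a set_system \<Rightarrow> 'a set \<Rightarrow> bool" where
  "base M B \<longleftrightarrow> maximal_in (indeps M) B"

locale matroid =
  fixes M :: "'a set_system"
  assumes indeps_ground: "I \<in> indeps M \<Longrightarrow> I \<subseteq> ground M"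
    and I1: "{} \<in> indeps M"
    and I2: "I \<in> indeps M \<Longrightarrow> J \<subseteq> I \<Longrightarrow> J \<in> indeps M"
    and I3: "I \<in> indeps M \<Longrightarrow> \<not> base M I \<Longrightarrow> base M B \<Longrightarrow>
               \<exists>x\<in>B - I. insert x I \<in> indeps M"
    and IM: "I \<in> indeps M \<Longrightarrow> I \<subseteq> X \<Longrightarrow> X \<subseteq> ground M \<Longrightarrow>
               \<exists>B. maximal_in {J \<in> indeps M. I \<subseteq> J \<and> J \<subseteq> X} B"

text \<open>The bases of the dual are the complements of the bases.\<close>

definition dual_matroid :: "'a set_system \<Rightarrow> 'a set_system" where
  "dual_matroid M =
     \<lparr>ground = ground M, indeps = {I. \<exists>B. base M B \<and> I \<subseteq> ground M - B}\<rparr>"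

definition circuit :: "'a set_system \<Rightarrow> 'a set \<Rightarrow> bool" where
  "circuit M C \<longleftrightarrow> C \<subseteq> ground M \<and> C \<notin> indeps M \<and> (\<forall>D. D \<subset> C \<longrightarrow> D \<in> indeps M)"

definition cocircuit :: "'a set_system \<Rightarrow> 'a set \<Rightarrow> bool" where
  "cocircuit M D \<longleftrightarrow> circuit (dual_matroid M) D"

definition tame :: "'a set_system \<Rightarrow> bool" where
  "tame M \<longleftrightarrow> (\<forall>C D. circuit M C \<and> cocircuit M D \<longrightarrow> finite (C \<inter> D))"

definition deletion :: "'a set_system \<Rightarrow> 'a set \<Rightarrow> 'a set_system" where
  "deletion M D = \<lparr>ground = ground M - D, indeps = {I \<in> indeps M. I \<inter> D = {}}\<rparr>"

definition contraction :: "'a set_system \<Rightarrow> 'a set \<Rightarrow> 'a set_system" where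
  "contraction M C = dual_matroid (deletion (dual_matroid M) C)"

definition minor_of :: "'a set_system \<Rightarrow> 'a set_system \<Rightarrow> bool" where
  "minor_of N M \<longleftrightarrow>
     (\<exists>C D. C \<subseteq> ground M \<and> D \<subseteq> ground M \<and> C \<inter> D = {} \<and> N = deletion (contraction M C) D)"

record 'a signed_set =
  pos :: "'a set"
  neg :: "'a set"

definition signed_subset :: "'a set \<Rightarrow> 'a signed_set \<Rightarrow> bool" where
  "signed_subset E X \<longleftrightarrow> pos X \<subseteq> E \<and> neg X \<subseteq> E \<and> pos X \<inter> neg X = {}"

definition supp :: "'a signed_set \<Rightarrow> 'a set" where
  "supp X = pos X \<union> neg X"

definition opposite :: "'a signed_set \<Rightarrow> 'a signed_set" where
  "opposite X = \<lparr>pos = neg X, neg = pos X\<rparr>"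

text \<open>The value 0 off the support is a dummy: orthogonality evaluates signs only on supports.\<close>

definition sign_at :: "'a signed_set \<Rightarrow> 'a \<Rightarrow> int" where
  "sign_at X e = (if e \<in> pos X then 1 else if e \<in> neg X then -1 else 0)"

definition orthogonal_signed :: "'a signed_set \<Rightarrow> 'a signed_set \<Rightarrow> bool" where
  "orthogonal_signed X Y \<longleftrightarrow>
     supp X \<inter> supp Y = {} \<or>
     (\<exists>e\<in>supp X \<inter> supp Y. \<exists>f\<in>supp X \<inter> supp Y.
        sign_at X e * sign_at Y e = - (sign_at X f * sign_at Y f))"

text \<open>Circuits of a matroid are nonempty, so a signed subset supported by a circuit always
  differs from its opposite.\<close>

definition circuit_signature :: "'a set_system \<Rightarrow> 'a signed_set set \<Rightarrow> bool" where
  "circuit_signature M S \<longleftrightarrow>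
     (\<forall>X\<in>S. signed_subset (ground M) X \<and> circuit M (supp X)) \<and>
     (\<forall>C. circuit M C \<longrightarrow> (\<exists>X. {Y \<in> S. supp Y = C} = {X, opposite X}))"

definition cocircuit_signature :: "'a set_system \<Rightarrow> 'a signed_set set \<Rightarrow> bool" where
  "cocircuit_signature M S \<longleftrightarrow> circuit_signature (dual_matroid M) S"

definition orthogonally_orientable :: "'a set_system \<Rightarrow> bool" where
  "orthogonally_orientable M \<longleftrightarrow>
     (\<exists>S T. circuit_signature M S \<and> cocircuit_signature M T \<and>
        (\<forall>X\<in>S. \<forall>Y\<in>T. orthogonal_signed X Y))"

end

theory Submission imports Defs "HOL-Analysis.Function_Topology" begin

text \<open>Let \<open>N\<close> arise from \<open>M\<close> by contracting \<open>C\<close> and deleting \<open>D\<close>. Every circuit \<open>A\<close> of \<open>N\<close> extends to a circuit \<open>X\<close> of \<open>M\<close> with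
  \<open>A \<subseteq> X \<subseteq> A \<union> C\<close>, and every cocircuit \<open>B\<close> of \<open>N\<close> to a cocircuit \<open>Y\<close> of \<open>M\<close> with
  \<open>B \<subseteq> Y \<subseteq> B \<union> D\<close>. Then \<open>X \<inter> Y = A \<inter> B\<close>, so the signs of \<open>M\<close> restrict to \<open>N\<close>.

  Conversely, tameness makes the orthogonality of a circuit and a cocircuit a condition on
  finitely many signs, so by compactness it suffices to sign finitely many circuits \<open>X\<^sub>i\<close> and
  cocircuits \<open>Y\<^sub>j\<close>. Contract the elements that lie in some \<open>X\<^sub>i\<close> but in no \<open>Y\<^sub>j\<close>, and delete
  those that lie in no \<open>X\<^sub>i\<close>. The ground set of this minor is the union of the finite sets
  \<open>X\<^sub>i \<inter> Y\<^sub>j\<close>, and the trace of each \<open>X\<^sub>i\<close> (of each \<open>Y\<^sub>j\<close>) on it is a union of circuits (of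
  cocircuits) of the minor. Composing the signed circuits in such a union, as one composes
  vectors of an oriented matroid, preserves orthogonality.\<close>

section \<open>Infinite matroids\<close>

text \<open>Maximality is tested on one-element extensions; in a matroid, heredity \<open>I2\<close>
  makes this the same as inclusion-maximality among the independent subsets of
  \<open>X\<close>.\<close>

definition basis_in :: "'a set_system \<Rightarrow> 'a set \<Rightarrow> 'a set \<Rightarrow> bool" where
  "basis_in M X K \<longleftrightarrow> K \<in> indeps M \<and> K \<subseteq> X \<and> (\<forall>x\<in>X - K. insert x K \<notin> indeps M)"

section \<open>Relative bases and exchange\<close>

context matroid
begin

text \<open>Once \<open>K\<close> contains \<open>I\<close>, so does every competitor above
  \<open>K\<close>. Thus \<open>IM\<close> supplies bases of \<open>X\<close> that contain
  \<open>I\<close>.\<close>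

lemma maximal_in_interval_iff:
  assumes "I \<subseteq> X"
  shows "maximal_in {J \<in> indeps M. I \<subseteq> J \<and> J \<subseteq> X} K \<longleftrightarrow> I \<subseteq> K \<and> basis_in M X K"
proof
  assume L: "maximal_in {J \<in> indeps M. I \<subseteq> J \<and> J \<subseteq> X} K"
  show "I \<subseteq> K \<and> basis_in M X K"
    unfolding basis_in_def
  proof (intro conjI ballI notI)
    fix x assume x: "x \<in> X - K" "insert x K \<in> indeps M"
    then have "insert x K = K" using L unfolding maximal_in_def by blast
    then show False using x by blast
  qed (use L in \<open>auto simp: maximal_in_def\<close>)
next
  assume R: "I \<subseteq> K \<and> basis_in M X K"
  have "J = K" if J: "J \<in> indeps M" "J \<subseteq> X" "K \<subseteq> J" for J
  proof (rule ccontr)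
    assume "J \<noteq> K"
    then obtain x where x: "x \<in> J - K" using J by blast
    then have "insert x K \<in> indeps M" using J I2[of J "insert x K"] by blast
    then show False using R x J unfolding basis_in_def by blast
  qed
  then show "maximal_in {J \<in> indeps M. I \<subseteq> J \<and> J \<subseteq> X} K"
    using R unfolding maximal_in_def basis_in_def by blast
qed

lemma base_iff_basis_in: "base M B \<longleftrightarrow> basis_in M (ground M) B"
proof -
  have "indeps M = {J \<in> indeps M. {} \<subseteq> J \<and> J \<subseteq> ground M}"
    using indeps_ground by blast
  then show ?thesis
    using maximal_in_interval_iff[of "{}" "ground M" B] unfolding base_def by simp
qed

lemma base_indep: "base M B \<Longrightarrow> B \<in> indeps M"
  by (simp add: base_def maximal_in_def)

lemma base_ground: "base M B \<Longrightarrow> B \<subseteq> ground M"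
  using base_indep indeps_ground by blast

lemma base_subset_eq: "base M B \<Longrightarrow> base M B' \<Longrightarrow> B \<subseteq> B' \<Longrightarrow> B = B'"
  by (auto simp: base_def maximal_in_def)

lemma basis_in_extends:
  assumes "I \<in> indeps M" "I \<subseteq> X" "X \<subseteq> ground M"
  shows "\<exists>K. basis_in M X K \<and> I \<subseteq> K"
  using IM[OF assms] maximal_in_interval_iff[OF assms(2)] by blast

lemma base_extends:
  assumes "I \<in> indeps M"
  shows "\<exists>B. base M B \<and> I \<subseteq> B"
  using basis_in_extends[OF assms indeps_ground[OF assms] order_refl]
  by (simp add: base_iff_basis_in)

text \<open>The contrapositive of \<open>I3\<close>: a base is recognised by testing only the
  elements of one known base.\<close>

lemma baseI:
  assumes "J \<in> indeps M" "base M B" "\<And>y. y \<in> B - J \<Longrightarrow> insert y J \<notin> indeps M"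
  shows "base M J"
  using I3[OF assms(1) _ assms(2)] assms(3) by blast

lemma basis_in_supset_base_is_base:
  assumes "basis_in M X J" "base M B" "B \<subseteq> X"
  shows "base M J"
  using assms by (intro baseI[of J B]) (auto simp: basis_in_def)

text \<open>Replacing the part of \<open>B'\<close> inside \<open>C\<close> by
  \<open>B \<inter> C\<close> gives a base again, and it lies inside \<open>B\<close>. This
  minimality of \<open>B\<close> outside \<open>C\<close> takes the place of rank counting.\<close>

lemma base_diff_minimal:
  assumes B: "base M B" "basis_in M C (B \<inter> C)" and B': "base M B'" "B' - C \<subseteq> B - C"
  shows "B' - C = B - C"
proof (rule ccontr)
  assume ne: "B' - C \<noteq> B - C"
  let ?J = "(B' - C) \<union> (B \<inter> C)"
  have J: "?J \<in> indeps M" using B' I2[OF base_indep[OF B(1)], of ?J] by blast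
  have base: "base M ?J"
  proof (rule baseI[OF J B'(1)])
    fix y assume y: "y \<in> B' - ?J"
    then have "insert y (B \<inter> C) \<notin> indeps M" using B(2) unfolding basis_in_def by blast
    then show "insert y ?J \<notin> indeps M" using I2[of "insert y ?J" "insert y (B \<inter> C)"] by blast
  qed
  have "?J = B" using base_subset_eq[OF base B(1)] B'(2) by blast
  then show False using ne by blast
qed

text \<open>\<open>K\<close> extends to a base inside \<open>K \<union> (B - C)\<close>, and
  \<open>base_diff_minimal\<close> forbids it to lose an element of \<open>B - C\<close>. This makes
  independence in a contraction independent of the chosen basis of \<open>C\<close>.\<close>

lemma basis_in_exchange:
  assumes B: "base M B" "basis_in M C (B \<inter> C)" and K: "basis_in M C K" and C: "C \<subseteq> ground M"
  shows "base M (K \<union> (B - C))"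
proof -
  have "K \<union> (B - C) \<subseteq> ground M" using base_ground[OF B(1)] K C by (auto simp: basis_in_def)
  then obtain J where J: "basis_in M (K \<union> (B - C)) J" "K \<subseteq> J"
    using basis_in_extends[of K "K \<union> (B - C)"] K by (auto simp: basis_in_def)
  have Ji: "J \<in> indeps M" using J by (simp add: basis_in_def)
  have base: "base M J"
  proof (rule baseI[OF Ji B(1)])
    fix y assume y: "y \<in> B - J"
    show "insert y J \<notin> indeps M"
    proof (cases "y \<in> C")
      case True
      then have "insert y K \<notin> indeps M" using K y J unfolding basis_in_def by blast
      then show ?thesis using J(2) I2[of "insert y J" "insert y K"] by blast
    next
      case False
      then show ?thesis using y J unfolding basis_in_def by blast
    qed
  qed
  have "J - C \<subseteq> B - C" using J K by (auto simp: basis_in_def)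
  then have "J - C = B - C" using base_diff_minimal[OF B base] by blast
  moreover have "J \<inter> C = K" using J K by (auto simp: basis_in_def)
  ultimately have "J = K \<union> (B - C)" by blast
  then show ?thesis using base by simp
qed

lemma base_Int_basis_in:
  assumes "basis_in M C K" "base M B" "K \<subseteq> B"
  shows "B \<inter> C = K"
proof -
  have "x \<in> K" if "x \<in> B \<inter> C" for x
  proof (rule ccontr)
    assume "x \<notin> K"
    then have "insert x K \<notin> indeps M" using that assms unfolding basis_in_def by blast
    then show False using I2[OF base_indep[OF assms(2)], of "insert x K"] that assms by blast
  qed
  then show ?thesis using assms unfolding basis_in_def by blast
qed

text \<open>This is \<open>I3\<close> relative to \<open>X\<close>. If no element of
  \<open>B\<close> augments \<open>I\<close>, then one and the same set outside \<open>X\<close>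
  completes both \<open>I\<close> and \<open>insert y I\<close> to bases, and these are properly
  nested.\<close>

lemma basis_in_augment:
  assumes I: "I \<in> indeps M" "I \<subseteq> X" and y: "y \<in> X - I" "insert y I \<in> indeps M"
    and B: "basis_in M X B" and X: "X \<subseteq> ground M"
  shows "\<exists>x\<in>B - I. insert x I \<in> indeps M"
proof (rule ccontr)
  assume no: "\<not> ?thesis"
  obtain B' where B': "base M B'" "B \<subseteq> B'"
    using base_extends[of B] B by (auto simp: basis_in_def)
  have B'X: "B' \<inter> X = B" by (rule base_Int_basis_in[OF B B'])
  \<comment> \<open>A base \<open>J\<close> with
    \<open>H \<subseteq> J \<subseteq> H \<union> B'\<close> gains nothing inside \<open>X\<close>,
    since by \<open>no\<close> its elements in \<open>B\<close> already lie in \<open>I\<close>;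
    minimality outside \<open>X\<close> then forces all of \<open>B' - X\<close> into
    \<open>J\<close>.\<close>
  have fill: "base M (H \<union> (B' - X))" if H: "H \<in> indeps M" "I \<subseteq> H" "H \<subseteq> X" for H
  proof -
    have "H \<union> B' \<subseteq> ground M" using H X base_ground[OF B'(1)] by blast
    then obtain J where J: "basis_in M (H \<union> B') J" "H \<subseteq> J"
      using basis_in_extends[of H "H \<union> B'"] H by blast
    have Ji: "J \<in> indeps M" using J by (simp add: basis_in_def)
    have base: "base M J" by (rule basis_in_supset_base_is_base[OF J(1) B'(1)]) blast
    have "J \<inter> B \<subseteq> I"
    proof
      fix x assume x: "x \<in> J \<inter> B"
      then have "insert x I \<in> indeps M" using J(2) H(2) I2[OF Ji, of "insert x I"] by blast
      then show "x \<in> I" using no x by blast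
    qed
    then have JX: "J \<inter> X = H" using J H B'X by (auto simp: basis_in_def)
    have "J - X \<subseteq> B' - X" using J H by (auto simp: basis_in_def)
    then have "J - X = B' - X" using base_diff_minimal[OF B'(1) _ base] B B'X by simp
    then have "J = H \<union> (B' - X)" using JX by blast
    then show ?thesis using base by simp
  qed
  have "base M (I \<union> (B' - X))" using fill[of I] I by blast
  moreover have "base M (insert y I \<union> (B' - X))" using fill[of "insert y I"] I y by blast
  ultimately have "I \<union> (B' - X) = insert y I \<union> (B' - X)" by (rule base_subset_eq) blast
  then show False using y by blast
qed

section \<open>Deletion and duality\<close>

lemma matroid_deletion: "matroid (deletion M D)"
proof
  fix I assume "I \<in> indeps (deletion M D)"
  then show "I \<subseteq> ground (deletion M D)" using indeps_ground by (auto simp: deletion_def)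
next
  show "{} \<in> indeps (deletion M D)" using I1 by (simp add: deletion_def)
next
  fix I J assume "I \<in> indeps (deletion M D)" "J \<subseteq> I"
  then show "J \<in> indeps (deletion M D)" using I2 by (auto simp: deletion_def)
next
  have eq: "indeps (deletion M D) = {J \<in> indeps M. {} \<subseteq> J \<and> J \<subseteq> ground M - D}"
    using indeps_ground by (auto simp: deletion_def)
  have max: "base (deletion M D) B \<longleftrightarrow> basis_in M (ground M - D) B" for B
    unfolding base_def eq by (subst maximal_in_interval_iff) auto
  fix I B assume I: "I \<in> indeps (deletion M D)" "\<not> base (deletion M D) I"
    and B: "base (deletion M D) B"
  have I': "I \<in> indeps M" "I \<subseteq> ground M - D" using I eq by auto
  then obtain y where y: "y \<in> ground M - D - I" "insert y I \<in> indeps M"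
    using I(2) unfolding max basis_in_def by blast
  obtain x where "x \<in> B - I" "insert x I \<in> indeps M"
    using basis_in_augment[OF I' y] B max by blast
  moreover have "x \<notin> D" using \<open>x \<in> B - I\<close> B by (auto simp: max basis_in_def)
  ultimately show "\<exists>x\<in>B - I. insert x I \<in> indeps (deletion M D)"
    using I by (auto simp: deletion_def)
next
  fix I X assume A: "I \<in> indeps (deletion M D)" "I \<subseteq> X" "X \<subseteq> ground (deletion M D)"
  then have "{J \<in> indeps (deletion M D). I \<subseteq> J \<and> J \<subseteq> X} = {J \<in> indeps M. I \<subseteq> J \<and> J \<subseteq> X}"
    by (auto simp: deletion_def)
  moreover have "I \<in> indeps M" "X \<subseteq> ground M" using A by (auto simp: deletion_def)
  ultimately show "\<exists>B. maximal_in {J \<in> indeps (deletion M D). I \<subseteq> J \<and> J \<subseteq> X} B"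
    using IM[of I X] A(2) by simp
qed

lemma dual_indep_iff: "I \<in> indeps (dual_matroid M) \<longleftrightarrow> (\<exists>B. base M B \<and> I \<subseteq> ground M - B)"
  by (simp add: dual_matroid_def)

lemma ground_dual [simp]: "ground (dual_matroid M) = ground M"
  by (simp add: dual_matroid_def)

lemma base_dual_iff: "base (dual_matroid M) D \<longleftrightarrow> (\<exists>B. base M B \<and> D = ground M - B)"
proof
  assume "base (dual_matroid M) D"
  then have D: "D \<in> indeps (dual_matroid M)"
    and max: "\<And>I. I \<in> indeps (dual_matroid M) \<Longrightarrow> D \<subseteq> I \<Longrightarrow> I = D"
    unfolding base_def[of "dual_matroid M"] maximal_in_def by blast+
  obtain B where B: "base M B" "D \<subseteq> ground M - B" using D dual_indep_iff by blast
  moreover have "ground M - B \<in> indeps (dual_matroid M)" using B(1) dual_indep_iff by blast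
  ultimately show "\<exists>B. base M B \<and> D = ground M - B" using max by blast
next
  assume "\<exists>B. base M B \<and> D = ground M - B"
  then obtain B where B: "base M B" "D = ground M - B" by blast
  have max: "I = D" if I: "base M B'" "I \<subseteq> ground M - B'" "D \<subseteq> I" for I B'
  proof -
    have "B' \<subseteq> B" using I B base_ground[OF I(1)] by blast
    then have "B' = B" using base_subset_eq[OF I(1) B(1)] by blast
    then show ?thesis using I B by blast
  qed
  show "base (dual_matroid M) D"
    unfolding base_def[of "dual_matroid M"] maximal_in_def
  proof (intro conjI ballI impI)
    show "D \<in> indeps (dual_matroid M)" using B by (auto simp: dual_indep_iff)
    fix I assume "I \<in> indeps (dual_matroid M)" "D \<subseteq> I"
    then show "I = D" using max by (auto simp: dual_indep_iff)
  qed
qed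

lemma coindep_basis_in_is_base:
  assumes "I \<in> indeps (dual_matroid M)" "basis_in M (ground M - I) B"
  shows "base M B"
proof -
  obtain B1 where "base M B1" "I \<subseteq> ground M - B1" using assms dual_indep_iff by blast
  then show ?thesis
    using basis_in_supset_base_is_base[OF assms(2)] base_ground by blast
qed

lemma matroid_dual: "matroid (dual_matroid M)"
proof
  fix I assume "I \<in> indeps (dual_matroid M)"
  then show "I \<subseteq> ground (dual_matroid M)" by (auto simp: dual_indep_iff)
next
  obtain B where "base M B" using base_extends[OF I1] by blast
  then show "{} \<in> indeps (dual_matroid M)" by (auto simp: dual_indep_iff)
next
  fix I J assume "I \<in> indeps (dual_matroid M)" "J \<subseteq> I"
  then show "J \<in> indeps (dual_matroid M)" unfolding dual_indep_iff by blast
next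
  fix I B' assume I: "I \<in> indeps (dual_matroid M)" "\<not> base (dual_matroid M) I"
    and "base (dual_matroid M) B'"
  then obtain B where B: "base M B" "B' = ground M - B" using base_dual_iff by blast
  \<comment> \<open>The base \<open>J\<close> below avoids \<open>I\<close> and contains
    \<open>B - I\<close>. So \<open>ground M - J\<close> is a cobase properly containing
    \<open>I\<close>, and its elements outside \<open>I\<close> lie outside
    \<open>B\<close>.\<close>
  have "B - I \<in> indeps M" by (rule I2[OF base_indep[OF B(1)]]) blast
  then obtain J where J: "basis_in M (ground M - I) J" "B - I \<subseteq> J"
    using basis_in_extends[of "B - I" "ground M - I"] base_ground[OF B(1)] by blast
  have base: "base M J" by (rule coindep_basis_in_is_base[OF I(1) J(1)])
  have "I \<subseteq> ground M" using I by (auto simp: dual_indep_iff)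
  then have sub: "I \<subseteq> ground M - J" using J by (auto simp: basis_in_def)
  have "I \<noteq> ground M - J" using base I base_dual_iff by blast
  then obtain x where x: "x \<in> ground M - J - I" using sub by blast
  then have "x \<in> B' - I" using B J by blast
  moreover have "insert x I \<in> indeps (dual_matroid M)"
    unfolding dual_indep_iff using base sub x by blast
  ultimately show "\<exists>x\<in>B' - I. insert x I \<in> indeps (dual_matroid M)" by blast
next
  fix I X assume A: "I \<in> indeps (dual_matroid M)" "I \<subseteq> X" "X \<subseteq> ground (dual_matroid M)"
  \<comment> \<open>For \<open>IM\<close> in the dual, the maximal set is \<open>X - B\<close> for a
    base \<open>B\<close> that avoids \<open>I\<close> and meets the complement of \<open>X\<close>
    in a basis of it; by \<open>base_diff_minimal\<close> no base has a smaller trace on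
    \<open>X\<close>.\<close>
  let ?C = "ground M - X"
  obtain K where K: "basis_in M ?C K"
    using basis_in_extends[OF I1, of ?C] by blast
  have "K \<in> indeps M" "K \<subseteq> ground M - I" using K A by (auto simp: basis_in_def)
  then obtain B where B: "basis_in M (ground M - I) B" "K \<subseteq> B"
    using basis_in_extends[of K "ground M - I"] by blast
  have base: "base M B" by (rule coindep_basis_in_is_base[OF A(1) B(1)])
  have BK: "B \<inter> ?C = K" by (rule base_Int_basis_in[OF K base B(2)])
  have "J = X - B" if J: "J \<in> indeps (dual_matroid M)" "J \<subseteq> X" "X - B \<subseteq> J" for J
  proof -
    obtain B' where B': "base M B'" "J \<subseteq> ground M - B'" using J dual_indep_iff by blast
    have "B' - ?C \<subseteq> B - ?C" using B' J base_ground[OF B'(1)] by blast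
    then have "B' - ?C = B - ?C" using base_diff_minimal[OF base _ B'(1)] K BK by simp
    then show ?thesis using B' J A by auto
  qed
  moreover have "X - B \<in> indeps (dual_matroid M)"
    unfolding dual_indep_iff using base A by auto
  moreover have "I \<subseteq> X - B" using A B by (auto simp: basis_in_def)
  ultimately have "maximal_in {J \<in> indeps (dual_matroid M). I \<subseteq> J \<and> J \<subseteq> X} (X - B)"
    unfolding maximal_in_def by blast
  then show "\<exists>B. maximal_in {J \<in> indeps (dual_matroid M). I \<subseteq> J \<and> J \<subseteq> X} B" ..
qed

section \<open>Contraction\<close>

lemma matroid_contraction: "matroid (contraction M C)"
  unfolding contraction_def
  by (intro matroid.matroid_dual matroid.matroid_deletion matroid_dual)

lemma ground_contraction [simp]: "ground (contraction M C) = ground M - C"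
  by (simp add: contraction_def deletion_def dual_matroid_def)

text \<open>Maximal sets \<open>ground M - C - B\<close> come from bases \<open>B\<close> that are
  minimal outside \<open>C\<close>, and these are the bases meeting \<open>C\<close> in a basis of
  \<open>C\<close>.\<close>

lemma base_deletion_dual_iff:
  assumes C: "C \<subseteq> ground M"
  shows "base (deletion (dual_matroid M) C) D \<longleftrightarrow>
    (\<exists>B. base M B \<and> basis_in M C (B \<inter> C) \<and> D = ground M - C - B)"
proof
  assume "base (deletion (dual_matroid M) C) D"
  then have D: "D \<in> indeps (deletion (dual_matroid M) C)"
    and max: "\<And>I. I \<in> indeps (deletion (dual_matroid M) C) \<Longrightarrow> D \<subseteq> I \<Longrightarrow> I = D"
    unfolding base_def maximal_in_def by blast+
  obtain B where B: "base M B" "D \<subseteq> ground M - B" "D \<inter> C = {}"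
    using D by (auto simp: deletion_def dual_indep_iff)
  have cand: "ground M - C - B' \<in> indeps (deletion (dual_matroid M) C)" if "base M B'" for B'
    using that by (auto simp: deletion_def dual_indep_iff)
  have DB: "D = ground M - C - B" using max[OF cand[OF B(1)]] B by blast
  have "basis_in M C (B \<inter> C)"
    unfolding basis_in_def
  proof (intro conjI ballI notI)
    \<comment> \<open>If \<open>x\<close> could still be added to \<open>B \<inter> C\<close>, trade
      it in: the base \<open>J\<close> keeps \<open>B \<inter> C\<close>, gains \<open>x\<close> and
      must drop an element of \<open>B - C\<close>, against the maximality of
      \<open>D\<close>.\<close>
    fix x assume x: "x \<in> C - B \<inter> C" "insert x (B \<inter> C) \<in> indeps M"
    then obtain J where J: "basis_in M (insert x B) J" "insert x (B \<inter> C) \<subseteq> J"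
      using basis_in_extends[of "insert x (B \<inter> C)" "insert x B"] C base_ground[OF B(1)] by blast
    have base: "base M J" by (rule basis_in_supset_base_is_base[OF J(1) B(1)]) blast
    have "J \<noteq> insert x B"
      using base_subset_eq[OF B(1) base] x by blast
    then have "ground M - C - J \<noteq> D" using J x DB base_ground[OF B(1)] by (auto simp: basis_in_def)
    moreover have "D \<subseteq> ground M - C - J" using J x DB by (auto simp: basis_in_def)
    ultimately show False using max[OF cand[OF base]] by blast
  qed (use I2[OF base_indep[OF B(1)], of "B \<inter> C"] in auto)
  then show "\<exists>B. base M B \<and> basis_in M C (B \<inter> C) \<and> D = ground M - C - B"
    using B DB by blast
next
  assume "\<exists>B. base M B \<and> basis_in M C (B \<inter> C) \<and> D = ground M - C - B"
  then obtain B where B: "base M B" "basis_in M C (B \<inter> C)" "D = ground M - C - B" by blast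
  have max: "I = D" if I: "base M B'" "I \<subseteq> ground M - B'" "I \<inter> C = {}" "D \<subseteq> I" for I B'
  proof -
    have "B' - C \<subseteq> B - C" using I B base_ground[OF I(1)] by blast
    then have "B' - C = B - C" using base_diff_minimal[OF B(1,2) I(1)] by blast
    then show ?thesis using I B by blast
  qed
  show "base (deletion (dual_matroid M) C) D"
    unfolding base_def[of "deletion (dual_matroid M) C"] maximal_in_def
  proof (intro conjI ballI impI)
    show "D \<in> indeps (deletion (dual_matroid M) C)"
      using B by (auto simp: deletion_def dual_indep_iff)
    fix I assume "I \<in> indeps (deletion (dual_matroid M) C)" "D \<subseteq> I"
    then show "I = D" using max by (auto simp: deletion_def dual_indep_iff)
  qed
qed

text \<open>Recovers the usual description of a contraction from its definition through the dual:
  the independent sets are the subsets of \<open>B - C\<close> for bases \<open>B\<close> meeting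
  \<open>C\<close> in a basis, and \<open>basis_in_exchange\<close> replaces that basis by the fixed
  \<open>K\<close>.\<close>

lemma contraction_indep_iff:
  assumes C: "C \<subseteq> ground M" and K: "basis_in M C K"
  shows "I \<in> indeps (contraction M C) \<longleftrightarrow> I \<inter> C = {} \<and> I \<union> K \<in> indeps M"
proof -
  have g: "ground (deletion (dual_matroid M) C) = ground M - C" by (simp add: deletion_def)
  have "I \<in> indeps (contraction M C) \<longleftrightarrow>
      (\<exists>D. base (deletion (dual_matroid M) C) D \<and> I \<subseteq> ground M - C - D)"
    unfolding contraction_def dual_matroid_def[of "deletion _ _"] g by simp
  also have "\<dots> \<longleftrightarrow> (\<exists>B. base M B \<and> basis_in M C (B \<inter> C) \<and> I \<subseteq> B - C)"
    unfolding base_deletion_dual_iff[OF C] using base_ground by blast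
  also have "\<dots> \<longleftrightarrow> I \<inter> C = {} \<and> I \<union> K \<in> indeps M"
  proof
    assume "\<exists>B. base M B \<and> basis_in M C (B \<inter> C) \<and> I \<subseteq> B - C"
    then obtain B where B: "base M B" "basis_in M C (B \<inter> C)" "I \<subseteq> B - C" by blast
    have "K \<union> (B - C) \<in> indeps M" using basis_in_exchange[OF B(1,2) K C] base_indep by blast
    then show "I \<inter> C = {} \<and> I \<union> K \<in> indeps M" using B I2[of "K \<union> (B - C)" "I \<union> K"] by blast
  next
    assume R: "I \<inter> C = {} \<and> I \<union> K \<in> indeps M"
    then obtain B where B: "base M B" "I \<union> K \<subseteq> B" using base_extends by blast
    then have "B \<inter> C = K" using base_Int_basis_in[OF K] by blast
    then show "\<exists>B. base M B \<and> basis_in M C (B \<inter> C) \<and> I \<subseteq> B - C" using B K R by auto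
  qed
  finally show ?thesis .
qed

section \<open>Circuits and their behaviour under minors\<close>

lemma circuitI:
  assumes "C \<subseteq> ground M" "C \<notin> indeps M" "\<And>y. y \<in> C \<Longrightarrow> C - {y} \<in> indeps M"
  shows "circuit M C"
  unfolding circuit_def
proof (intro conjI allI impI)
  fix D assume "D \<subset> C"
  then obtain y where "y \<in> C" "D \<subseteq> C - {y}" by blast
  then show "D \<in> indeps M" using assms(3) I2[of "C - {y}" D] by blast
qed (use assms in auto)

lemma base_insert_contains_circuit:
  assumes B: "base M B" and x: "x \<in> ground M - B"
  shows "\<exists>C\<subseteq>insert x B. circuit M C"
proof -
  \<comment> \<open>Circuits may be infinite, so none can be found by shrinking; instead write down the
    fundamental circuit.\<close>
  define C where "C = {y \<in> insert x B. insert x B - {y} \<in> indeps M}"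
  have "x \<in> C" using x base_indep[OF B] by (auto simp: C_def)
  have Cg: "C \<subseteq> ground M" "C \<subseteq> insert x B" using base_ground[OF B] x by (auto simp: C_def)
  have "C \<notin> indeps M"
  proof
    assume "C \<in> indeps M"
    \<comment> \<open>The base \<open>J\<close> misses some \<open>y\<close> in \<open>B\<close>.
      Exchange from \<open>J\<close> into \<open>B - {y}\<close> can only bring in \<open>x\<close>,
      so \<open>y\<close> belongs to \<open>C\<close> and hence to \<open>J\<close>, a
      contradiction.\<close>
    then obtain J where J: "basis_in M (insert x B) J" "C \<subseteq> J"
      using basis_in_extends[of C "insert x B"] Cg base_ground[OF B] x by blast
    have base: "base M J" by (rule basis_in_supset_base_is_base[OF J(1) B]) blast
    have xJ: "x \<in> J" using J \<open>x \<in> C\<close> by blast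
    have sub: "J \<subseteq> insert x B" using J by (simp add: basis_in_def)
    have "J \<noteq> insert x B" using base_subset_eq[OF B base] x by blast
    then obtain y where y: "y \<in> B" "y \<notin> J" using sub xJ by blast
    have "B - {y} \<in> indeps M" by (rule I2[OF base_indep[OF B]]) blast
    moreover have "\<not> base M (B - {y})" using base_subset_eq[OF _ B, of "B - {y}"] y by blast
    ultimately obtain w where w: "w \<in> J - (B - {y})" "insert w (B - {y}) \<in> indeps M"
      using I3 base by blast
    have "w = x" using w sub y by blast
    moreover have "insert x B - {y} = insert x (B - {y})" using y x by blast
    ultimately have "y \<in> C" using w y by (simp add: C_def)
    then show False using J y by blast
  qed
  moreover have "C - {y} \<in> indeps M" if "y \<in> C" for y
    using that I2[of "insert x B - {y}" "C - {y}"] Cg by (auto simp: C_def)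
  ultimately show ?thesis using circuitI Cg by blast
qed

text \<open>In the restriction to \<open>X\<close> a basis \<open>K\<close> of \<open>X\<close> is a
  base, so any element of \<open>X - K\<close> closes a circuit with it.\<close>

lemma dependent_contains_circuit:
  assumes "X \<subseteq> ground M" "X \<notin> indeps M"
  shows "\<exists>C\<subseteq>X. circuit M C"
proof -
  obtain K where K: "basis_in M X K" using basis_in_extends[OF I1 _ assms(1)] by blast
  then have "K \<subseteq> X" "K \<noteq> X" using assms(2) by (auto simp: basis_in_def)
  then obtain x where x: "x \<in> X - K" by blast
  interpret R: matroid "deletion M (ground M - X)" by (rule matroid_deletion)
  have "base (deletion M (ground M - X)) K"
    unfolding R.base_iff_basis_in
    using K assms(1) by (auto simp: basis_in_def deletion_def)
  moreover have "x \<in> ground (deletion M (ground M - X)) - K"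
    using x assms(1) by (auto simp: deletion_def)
  ultimately obtain C where C: "C \<subseteq> insert x K" "circuit (deletion M (ground M - X)) C"
    using R.base_insert_contains_circuit by blast
  then have CX: "C \<subseteq> X" by (auto simp: circuit_def deletion_def)
  then have "circuit M C" using C assms(1) by (auto simp: circuit_def deletion_def)
  then show ?thesis using CX by blast
qed

lemma circuit_deletion_iff: "circuit (deletion M D) C \<longleftrightarrow> circuit M C \<and> C \<inter> D = {}"
  unfolding circuit_def deletion_def by auto

text \<open>With \<open>K\<close> a basis of \<open>C\<close>, the dependent set
  \<open>A \<union> K\<close> contains a circuit \<open>X\<close> of \<open>M\<close>. Its part
  outside \<open>C\<close> is dependent in the contraction, so it equals \<open>A\<close> by
  minimality.\<close>

lemma contraction_circuit_lift:
  assumes C: "C \<subseteq> ground M" and A: "circuit (contraction M C) A"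
  shows "\<exists>X. circuit M X \<and> A \<subseteq> X \<and> X \<subseteq> A \<union> C"
proof -
  obtain K where K: "basis_in M C K" using basis_in_extends[OF I1 _ C] by blast
  note ind = contraction_indep_iff[OF C K]
  have Ag: "A \<subseteq> ground M - C" and Ad: "A \<notin> indeps (contraction M C)"
    using A by (simp_all add: circuit_def)
  have "A \<union> K \<notin> indeps M" using Ad Ag ind by blast
  moreover have "A \<union> K \<subseteq> ground M" using Ag C K by (auto simp: basis_in_def)
  ultimately obtain X where X: "circuit M X" "X \<subseteq> A \<union> K"
    using dependent_contains_circuit by blast
  have "X \<subseteq> (X - C) \<union> K" using X Ag by blast
  then have "X - C \<union> K \<notin> indeps M" using X I2[of "X - C \<union> K" X] by (auto simp: circuit_def)
  then have "X - C \<notin> indeps (contraction M C)" using ind by blast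
  moreover have "X - C \<subseteq> A" using X K by (auto simp: basis_in_def)
  ultimately have "X - C = A" using A by (auto simp: circuit_def)
  then show ?thesis using X K by (auto simp: basis_in_def)
qed

text \<open>Over all \<open>e\<close>, this makes \<open>X - C\<close> a union of circuits of the
  contraction. The circuit through \<open>e\<close> is found in \<open>insert e I\<close>, where
  \<open>I\<close> is a basis of \<open>X - C - {e}\<close> in the contraction; the work is to see
  that \<open>insert e I\<close> is dependent.\<close>

lemma circuit_diff_contraction:
  assumes C: "C \<subseteq> ground M" and X: "circuit M X" and e: "e \<in> X - C"
  shows "\<exists>A. circuit (contraction M C) A \<and> e \<in> A \<and> A \<subseteq> X - C"
proof -
  interpret N: matroid "contraction M C" by (rule matroid_contraction)
  have Xg: "X \<subseteq> ground M" using X by (simp add: circuit_def)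
  have "X \<inter> C \<in> indeps M" using X e unfolding circuit_def by blast
  then obtain K where K: "basis_in M C K" "X \<inter> C \<subseteq> K"
    using basis_in_extends[OF _ _ C] by blast
  note ind = contraction_indep_iff[OF C K(1)]
  obtain I where I: "basis_in (contraction M C) (X - C - {e}) I"
    using N.basis_in_extends[OF N.I1, of "X - C - {e}"] Xg by auto
  have IX: "I \<subseteq> X - C - {e}" and Ii: "I \<in> indeps (contraction M C)"
    using I by (auto simp: basis_in_def)
  have IK: "I \<union> K \<in> indeps M" using Ii ind by blast
  have dep: "insert e I \<notin> indeps (contraction M C)"
  proof
    assume "insert e I \<in> indeps (contraction M C)"
    then have ins: "insert e (I \<union> K) \<in> indeps M" using ind by simp
    \<comment> \<open>A basis \<open>J\<close> of \<open>?P\<close> containing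
      \<open>X - {e}\<close> spans \<open>e\<close> because \<open>X\<close> is a circuit, so it
      stays a basis when \<open>e\<close> joins \<open>?P\<close>. Augmenting
      \<open>I \<union> K\<close> from \<open>J\<close> yields an element of
      \<open>X - C - {e}\<close> that contradicts the maximality of \<open>I\<close>.\<close>
    let ?P = "(X - C - {e}) \<union> K"
    have Pg: "insert e ?P \<subseteq> ground M" using Xg K C e by (auto simp: basis_in_def)
    have eP: "e \<notin> ?P" using e K by (auto simp: basis_in_def)
    have "X - {e} \<in> indeps M" using X e unfolding circuit_def by blast
    moreover have "X - {e} \<subseteq> ?P" using K by blast
    ultimately obtain J where J: "basis_in M ?P J" "X - {e} \<subseteq> J"
      using basis_in_extends[of "X - {e}" ?P] Pg by blast
    have "insert e J \<notin> indeps M"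
      using I2[of "insert e J" X] X J by (auto simp: circuit_def)
    then have Je: "basis_in M (insert e ?P) J" using J by (auto simp: basis_in_def)
    have IKP: "I \<union> K \<subseteq> insert e ?P" using IX by blast
    have eIK: "e \<in> insert e ?P - (I \<union> K)" using eP IX by blast
    obtain x where x: "x \<in> J - (I \<union> K)" "insert x (I \<union> K) \<in> indeps M"
      using basis_in_augment[OF IK IKP eIK ins Je Pg] by blast
    have xX: "x \<in> X - C - {e} - I" using x J by (auto simp: basis_in_def)
    then have "insert x I \<in> indeps (contraction M C)" using x ind Ii by auto
    then show False using I xX by (auto simp: basis_in_def)
  qed
  moreover have "insert e I \<subseteq> ground (contraction M C)" using IX e Xg by auto
  ultimately obtain A where A: "A \<subseteq> insert e I" "circuit (contraction M C) A"
    using N.dependent_contains_circuit[of "insert e I"] by blast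
  have "e \<in> A" using A N.I2[OF Ii, of A] by (auto simp: circuit_def)
  then show ?thesis using A IX e by blast
qed

end

text \<open>Immediate since \<open>contraction\<close> is defined through the dual. It presents
  cocircuits of a minor as circuits of a contraction, so the circuit lemmas apply to them.\<close>

lemma dual_minor_eq:
  "dual_matroid (deletion (contraction M C) D) = contraction (deletion (dual_matroid M) C) D"
  by (simp add: contraction_def)

section \<open>Orthogonality of sign functions\<close>

text \<open>Signs are Booleans: \<open>a e = b e\<close> encodes a positive product of signs at
  \<open>e\<close>, and \<open>a f \<noteq> b f\<close> a negative one at \<open>f\<close>. Only
  values on \<open>A \<inter> B\<close> are read.\<close>

definition orth :: "'a set \<Rightarrow> ('a \<Rightarrow> bool) \<Rightarrow> 'a set \<Rightarrow> ('a \<Rightarrow> bool) \<Rightarrow> bool" where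
  "orth A a B b \<longleftrightarrow> A \<inter> B = {} \<or> (\<exists>e\<in>A \<inter> B. \<exists>f\<in>A \<inter> B. a e = b e \<and> a f \<noteq> b f)"

lemma orth_commute: "orth A a B b \<longleftrightarrow> orth B b A a"
  unfolding orth_def Int_commute[of B A] by (simp add: eq_commute)

lemma orth_cong_Int: "A \<inter> B = A' \<inter> B' \<Longrightarrow> orth A a B b \<longleftrightarrow> orth A' a B' b"
  by (simp add: orth_def)

text \<open>Composition of vectors: the newly added set dictates the signs on all its elements. If
  it meets \<open>T j\<close>, its own two witnesses survive in the union; otherwise the
  intersection with \<open>T j\<close> and the signs there are unchanged.\<close>

lemma orth_composition:
  assumes "finite \<O>" "\<And>O' j. O' \<in> \<O> \<Longrightarrow> j \<in> J \<Longrightarrow> orth O' (\<sigma> O') (T j) (\<tau> j)"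
  shows "\<exists>v. \<forall>j\<in>J. orth (\<Union>\<O>) v (T j) (\<tau> j)"
  using assms
proof (induction \<O> rule: finite_induct)
  case empty
  then show ?case by (simp add: orth_def)
next
  case (insert A \<O>)
  then obtain v where v: "\<And>j. j \<in> J \<Longrightarrow> orth (\<Union>\<O>) v (T j) (\<tau> j)" by blast
  define w where "w = (\<lambda>e. if e \<in> A then \<sigma> A e else v e)"
  have "orth (\<Union>(insert A \<O>)) w (T j) (\<tau> j)" if j: "j \<in> J" for j
  proof (cases "A \<inter> T j = {}")
    case True
    then have "orth (\<Union>(insert A \<O>)) w (T j) (\<tau> j) \<longleftrightarrow> orth (\<Union>\<O>) w (T j) (\<tau> j)"
      by (intro orth_cong_Int) blast
    also have "\<dots> \<longleftrightarrow> orth (\<Union>\<O>) v (T j) (\<tau> j)"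
    proof -
      have "w e = v e" if "e \<in> T j" for e using True that by (auto simp: w_def)
      then show ?thesis unfolding orth_def by simp
    qed
    finally show ?thesis using v[OF j] by simp
  next
    case False
    have "orth A (\<sigma> A) (T j) (\<tau> j)" using insert.prems j by blast
    then obtain e f where "e \<in> A \<inter> T j" "f \<in> A \<inter> T j" "\<sigma> A e = \<tau> j e" "\<sigma> A f \<noteq> \<tau> j f"
      using False unfolding orth_def by blast
    then show ?thesis unfolding orth_def w_def
      by (intro disjI2 bexI[of _ e] bexI[of _ f]) auto
  qed
  then show ?case by blast
qed

section \<open>Signed sets as Boolean functions\<close>

definition signed_of :: "'a set \<Rightarrow> ('a \<Rightarrow> bool) \<Rightarrow> 'a signed_set" where
  "signed_of A a = \<lparr>pos = {e \<in> A. a e}, neg = {e \<in> A. \<not> a e}\<rparr>"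

lemma supp_signed_of [simp]: "supp (signed_of A a) = A"
  by (auto simp: supp_def signed_of_def)

lemma opposite_signed_of: "opposite (signed_of A a) = signed_of A (\<lambda>e. \<not> a e)"
  by (simp add: opposite_def signed_of_def)

lemma signed_of_pos:
  assumes "signed_subset E X"
  shows "X = signed_of (supp X) (\<lambda>e. e \<in> pos X)"
  using assms by (intro signed_set.equality) (auto simp: signed_subset_def signed_of_def supp_def)

lemma sign_at_signed_of: "e \<in> A \<Longrightarrow> sign_at (signed_of A a) e = (if a e then 1 else - 1)"
  by (simp add: sign_at_def signed_of_def)

lemma orthogonal_signed_of: "orthogonal_signed (signed_of A a) (signed_of B b) \<longleftrightarrow> orth A a B b"
proof -
  have "(\<exists>e\<in>A \<inter> B. \<exists>f\<in>A \<inter> B. sign_at (signed_of A a) e * sign_at (signed_of B b) e =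
            - (sign_at (signed_of A a) f * sign_at (signed_of B b) f)) \<longleftrightarrow>
        (\<exists>e\<in>A \<inter> B. \<exists>f\<in>A \<inter> B. (a e = b e) \<noteq> (a f = b f))"
    by (intro bex_cong refl) (auto simp: sign_at_signed_of)
  also have "\<dots> \<longleftrightarrow> (\<exists>e\<in>A \<inter> B. \<exists>f\<in>A \<inter> B. a e = b e \<and> a f \<noteq> b f)" by blast
  finally show ?thesis unfolding orthogonal_signed_def orth_def supp_signed_of by simp
qed

lemma circuit_signature_signed_of:
  "circuit_signature M {signed_of A a |A a. circuit M A \<and> (a = \<sigma> A \<or> a = (\<lambda>e. \<not> \<sigma> A e))}"
  (is "circuit_signature M ?S")
  unfolding circuit_signature_def
proof (intro conjI ballI allI impI)
  fix X assume "X \<in> ?S"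
  then obtain A a where X: "X = signed_of A a" "circuit M A" by blast
  then have "A \<subseteq> ground M" by (simp add: circuit_def)
  then show "signed_subset (ground M) X" by (auto simp: X(1) signed_subset_def signed_of_def)
  show "circuit M (supp X)" using X by simp
next
  fix C assume C: "circuit M C"
  have "{Y \<in> ?S. supp Y = C} = {signed_of C (\<sigma> C), opposite (signed_of C (\<sigma> C))}"
    using C by (auto simp: opposite_signed_of)
  then show "\<exists>X. {Y \<in> ?S. supp Y = C} = {X, opposite X}" by blast
qed

lemma circuit_signature_choice:
  assumes "circuit_signature M S"
  obtains \<sigma> where "\<And>A. circuit M A \<Longrightarrow> signed_of A (\<sigma> A) \<in> S"
proof -
  have "\<exists>a. signed_of A a \<in> S" if A: "circuit M A" for A
  proof -
    obtain X where "{Y \<in> S. supp Y = A} = {X, opposite X}"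
      using assms A unfolding circuit_signature_def by blast
    then have X: "X \<in> S" "supp X = A" by blast+
    then have "signed_subset (ground M) X" using assms by (auto simp: circuit_signature_def)
    then show ?thesis using signed_of_pos X by metis
  qed
  then show ?thesis using that by metis
qed

text \<open>Reversing one of two sign functions merely swaps the witnesses \<open>e\<close> and
  \<open>f\<close> of orthogonality, so one signing from each opposite pair carries all the
  information.\<close>

lemma orthogonally_orientable_iff:
  "orthogonally_orientable M \<longleftrightarrow>
    (\<exists>\<sigma> \<tau>. \<forall>A B. circuit M A \<and> cocircuit M B \<longrightarrow> orth A (\<sigma> A) B (\<tau> B))"
proof
  assume "orthogonally_orientable M"
  then obtain S T where S: "circuit_signature M S" and T: "circuit_signature (dual_matroid M) T"
    and ST: "\<forall>X\<in>S. \<forall>Y\<in>T. orthogonal_signed X Y"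
    unfolding orthogonally_orientable_def cocircuit_signature_def by blast
  obtain \<sigma> where \<sigma>: "\<And>A. circuit M A \<Longrightarrow> signed_of A (\<sigma> A) \<in> S"
    using circuit_signature_choice[OF S] by blast
  obtain \<tau> where \<tau>: "\<And>B. cocircuit M B \<Longrightarrow> signed_of B (\<tau> B) \<in> T"
    using circuit_signature_choice[OF T] cocircuit_def by metis
  show "\<exists>\<sigma> \<tau>. \<forall>A B. circuit M A \<and> cocircuit M B \<longrightarrow> orth A (\<sigma> A) B (\<tau> B)"
    using \<sigma> \<tau> ST orthogonal_signed_of by metis
next
  assume "\<exists>\<sigma> \<tau>. \<forall>A B. circuit M A \<and> cocircuit M B \<longrightarrow> orth A (\<sigma> A) B (\<tau> B)"
  then obtain \<sigma> \<tau> where st: "\<And>A B. circuit M A \<Longrightarrow> cocircuit M B \<Longrightarrow> orth A (\<sigma> A) B (\<tau> B)"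
    by blast
  have neg: "orth A a B b" if "orth A a' B b'" "a = a' \<or> a = (\<lambda>e. \<not> a' e)"
    "b = b' \<or> b = (\<lambda>e. \<not> b' e)" for A B and a a' b b' :: "'a \<Rightarrow> bool"
    using that unfolding orth_def by (elim disjE) (simp_all, blast+)
  let ?S = "{signed_of A a |A a. circuit M A \<and> (a = \<sigma> A \<or> a = (\<lambda>e. \<not> \<sigma> A e))}"
  let ?T = "{signed_of A a |A a. circuit (dual_matroid M) A \<and> (a = \<tau> A \<or> a = (\<lambda>e. \<not> \<tau> A e))}"
  have "\<forall>X\<in>?S. \<forall>Y\<in>?T. orthogonal_signed X Y"
  proof (intro ballI)
    fix X Y assume "X \<in> ?S" "Y \<in> ?T"
    then obtain A a B b where "X = signed_of A a" "circuit M A" "a = \<sigma> A \<or> a = (\<lambda>e. \<not> \<sigma> A e)"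
      "Y = signed_of B b" "cocircuit M B" "b = \<tau> B \<or> b = (\<lambda>e. \<not> \<tau> B e)"
      unfolding cocircuit_def by blast
    then show "orthogonal_signed X Y" using neg[OF st] by (simp add: orthogonal_signed_of)
  qed
  then show "orthogonally_orientable M"
    unfolding orthogonally_orientable_def cocircuit_signature_def
    using circuit_signature_signed_of by blast
qed

section \<open>Compactness\<close>

text \<open>Tychonoff: the Boolean cube is compact, a constraint reading finitely many coordinates
  defines a closed set, and the last assumption is the finite intersection property.\<close>

lemma finite_support_compactness:
  fixes sat :: "'q \<Rightarrow> ('i \<Rightarrow> bool) \<Rightarrow> bool"
  assumes fin: "\<And>q. q \<in> Q \<Longrightarrow> finite (V q)"
    and dep: "\<And>q s t. q \<in> Q \<Longrightarrow> (\<And>i. i \<in> V q \<Longrightarrow> s i = t i) \<Longrightarrow> sat q s \<Longrightarrow> sat q t"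
    and sat: "\<And>F. finite F \<Longrightarrow> F \<subseteq> Q \<Longrightarrow> \<exists>s. \<forall>q\<in>F. sat q s"
  shows "\<exists>s. \<forall>q\<in>Q. sat q s"
proof -
  let ?T = "product_topology (\<lambda>_::'i. discrete_topology (UNIV :: bool set)) UNIV"
  have top: "topspace ?T = UNIV" by simp
  have comp: "compact_space ?T"
    by (simp add: compact_space_product_topology compact_space_discrete_topology)
  have closed: "closedin ?T {s. sat q s}" if q: "q \<in> Q" for q
  proof -
    have "openin ?T {s. \<not> sat q s}"
    proof (subst openin_subopen, intro ballI)
      fix s assume s: "s \<in> {s. \<not> sat q s}"
      let ?U = "PiE UNIV (\<lambda>i. if i \<in> V q then {s i} else UNIV)"
      have "openin ?T ?U"
        using fin[OF q] by (intro product_topology_basis) (auto elim: finite_subset[rotated])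
      moreover have "s \<in> ?U" by auto
      moreover have "?U \<subseteq> {s. \<not> sat q s}"
      proof
        fix t assume t: "t \<in> ?U"
        have "t i = s i" if "i \<in> V q" for i using PiE_mem[OF t, of i] that by simp
        then show "t \<in> {s. \<not> sat q s}" using dep[OF q, of t s] s by blast
      qed
      ultimately show "\<exists>T. openin ?T T \<and> s \<in> T \<and> T \<subseteq> {s. \<not> sat q s}" by blast
    qed
    moreover have "UNIV - {s. sat q s} = {s. \<not> sat q s}" by blast
    ultimately show ?thesis unfolding closedin_def top by simp
  qed
  have "\<Inter>((\<lambda>q. {s. sat q s}) ` Q) \<noteq> {}"
  proof (rule comp[unfolded compact_space_fip, rule_format], intro conjI allI impI ballI)
    fix C assume "C \<in> (\<lambda>q. {s. sat q s}) ` Q"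
    then show "closedin ?T C" using closed by blast
  next
    fix \<F> assume "finite \<F> \<and> \<F> \<subseteq> (\<lambda>q. {s. sat q s}) ` Q"
    then obtain F where F: "F \<subseteq> Q" "finite F" "\<F> = (\<lambda>q. {s. sat q s}) ` F"
      using finite_subset_image by metis
    then show "\<Inter>\<F> \<noteq> {}" using sat[OF F(2,1)] by auto
  qed
  then show ?thesis by auto
qed

section \<open>Orientability and minors\<close>

lemma minor_orthogonally_orientable:
  assumes "matroid M" "minor_of N M" "orthogonally_orientable M"
  shows "orthogonally_orientable N"
proof -
  interpret matroid M by fact
  interpret D: matroid "dual_matroid M" by (rule matroid_dual)
  obtain C D where CD: "C \<subseteq> ground M" "D \<subseteq> ground M" "C \<inter> D = {}"
    and N: "N = deletion (contraction M C) D"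
    using assms(2) unfolding minor_of_def by blast
  interpret K: matroid "contraction M C" by (rule matroid_contraction)
  interpret L: matroid "deletion (dual_matroid M) C" by (rule D.matroid_deletion)
  obtain \<sigma> \<tau> where st: "\<And>A B. circuit M A \<Longrightarrow> cocircuit M B \<Longrightarrow> orth A (\<sigma> A) B (\<tau> B)"
    using assms(3) orthogonally_orientable_iff by blast
  have "\<exists>X. circuit N A \<longrightarrow> circuit M X \<and> A \<subseteq> X \<and> X \<subseteq> A \<union> C" for A
    using contraction_circuit_lift[OF CD(1)] unfolding N K.circuit_deletion_iff by metis
  then obtain f where f: "\<And>A. circuit N A \<Longrightarrow> circuit M (f A) \<and> A \<subseteq> f A \<and> f A \<subseteq> A \<union> C"
    by metis
  \<comment> \<open>The dual minor deletes \<open>C\<close> and contracts \<open>D\<close>, so a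
    cocircuit is lifted by adding elements of \<open>D\<close> only.\<close>
  have D: "D \<subseteq> ground (deletion (dual_matroid M) C)" using CD by (auto simp: deletion_def)
  have "\<exists>Y. cocircuit N B \<longrightarrow> cocircuit M Y \<and> B \<subseteq> Y \<and> Y \<subseteq> B \<union> D" for B
    using L.contraction_circuit_lift[OF D] unfolding cocircuit_def N dual_minor_eq
    by (metis D.circuit_deletion_iff)
  then obtain g where g: "\<And>B. cocircuit N B \<Longrightarrow> cocircuit M (g B) \<and> B \<subseteq> g B \<and> g B \<subseteq> B \<union> D"
    by metis
  have "orth A (\<sigma> (f A)) B (\<tau> (g B))" if "circuit N A" "cocircuit N B" for A B
  proof -
    have "A \<inter> C = {}" "A \<inter> D = {}"
      using that(1) by (auto simp: circuit_def N deletion_def)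
    moreover have "B \<inter> C = {}" "B \<inter> D = {}"
      using that(2) by (auto simp: cocircuit_def circuit_def dual_matroid_def N deletion_def)
    ultimately have "f A \<inter> g B = A \<inter> B" using f[OF that(1)] g[OF that(2)] CD(3) by blast
    then show ?thesis using st f[OF that(1)] g[OF that(2)] orth_cong_Int by metis
  qed
  then show ?thesis unfolding orthogonally_orientable_iff
    by (intro exI[of _ "\<lambda>A. \<sigma> (f A)"] exI[of _ "\<lambda>B. \<tau> (g B)"]) blast
qed

lemma finite_minor_signs:
  assumes "matroid M" and tame: "tame M"
    and minors: "\<And>N. minor_of N M \<Longrightarrow> finite (ground N) \<Longrightarrow> orthogonally_orientable N"
    and \<A>: "finite \<A>" "\<And>X. X \<in> \<A> \<Longrightarrow> circuit M X"
    and \<B>: "finite \<B>" "\<And>Y. Y \<in> \<B> \<Longrightarrow> cocircuit M Y"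
  obtains v w where "\<And>X Y. X \<in> \<A> \<Longrightarrow> Y \<in> \<B> \<Longrightarrow> orth X (v X) Y (w Y)"
proof -
  interpret matroid M by fact
  interpret D: matroid "dual_matroid M" by (rule matroid_dual)
  define F where "F = \<Union>\<A> \<inter> \<Union>\<B>"
  define C where "C = \<Union>\<A> - \<Union>\<B>"
  define D where "D = ground M - \<Union>\<A>"
  define N where "N = deletion (contraction M C) D"
  have \<A>g: "\<Union>\<A> \<subseteq> ground M" using \<A>(2) by (auto simp: circuit_def)
  have \<B>g: "\<Union>\<B> \<subseteq> ground M" using \<B>(2) unfolding cocircuit_def circuit_def by auto
  have CD: "C \<subseteq> ground M" "D \<subseteq> ground M" "C \<inter> D = {}" using \<A>g by (auto simp: C_def D_def)
  \<comment> \<open>Tameness enters here: \<open>F\<close>, the ground set of \<open>N\<close>, is a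
    finite union of finite intersections.\<close>
  have "finite (\<Union>X\<in>\<A>. \<Union>Y\<in>\<B>. X \<inter> Y)"
    using tame \<A> \<B> unfolding tame_def by (intro finite_UN_I) auto
  moreover have "F = (\<Union>X\<in>\<A>. \<Union>Y\<in>\<B>. X \<inter> Y)" by (auto simp: F_def)
  ultimately have finF: "finite F" by simp
  have gN: "ground N = F"
    using \<A>g unfolding N_def by (auto simp: deletion_def C_def D_def F_def)
  have "orthogonally_orientable N"
    using minors gN finF CD unfolding minor_of_def N_def by metis
  then obtain \<sigma> \<tau> where st: "\<And>A B. circuit N A \<Longrightarrow> cocircuit N B \<Longrightarrow> orth A (\<sigma> A) B (\<tau> B)"
    unfolding orthogonally_orientable_iff by blast
  interpret K: matroid "contraction M C" by (rule matroid_contraction)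
  interpret L: matroid "deletion (dual_matroid M) C" by (rule D.matroid_deletion)
  \<comment> \<open>Since \<open>X\<close> avoids \<open>D\<close>, the circuits of the contraction
    that cover \<open>X - C\<close> survive the deletion of \<open>D\<close>.\<close>
  have covX: "\<Union>{A. circuit N A \<and> A \<subseteq> X \<inter> F} = X \<inter> F" if X: "X \<in> \<A>" for X
  proof -
    have XC: "X - C = X \<inter> F" "(X \<inter> F) \<inter> D = {}" using X by (auto simp: C_def F_def D_def)
    have "\<exists>A. circuit N A \<and> e \<in> A \<and> A \<subseteq> X \<inter> F" if e: "e \<in> X \<inter> F" for e
    proof -
      obtain A where "circuit (contraction M C) A" "e \<in> A" "A \<subseteq> X \<inter> F"
        using circuit_diff_contraction[OF CD(1) \<A>(2)[OF X]] e XC(1) by metis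
      moreover from this have "A \<inter> D = {}" using XC(2) by blast
      ultimately show ?thesis unfolding N_def K.circuit_deletion_iff by blast
    qed
    then show ?thesis by blast
  qed
  \<comment> \<open>Dually, \<open>Y\<close> avoids \<open>C\<close> and so remains a circuit of the
    dual with \<open>C\<close> deleted; contracting \<open>D\<close> then covers
    \<open>Y - D\<close>.\<close>
  have covY: "\<Union>{B. cocircuit N B \<and> B \<subseteq> Y \<inter> F} = Y \<inter> F" if Y: "Y \<in> \<B>" for Y
  proof -
    have YD: "Y - D = Y \<inter> F" "Y \<inter> C = {}" using Y \<B>g by (auto simp: C_def F_def D_def)
    have Dg: "D \<subseteq> ground (deletion (dual_matroid M) C)" using CD by (auto simp: deletion_def)
    have "circuit (deletion (dual_matroid M) C) Y"
      using \<B>(2)[OF Y] YD(2) by (simp add: D.circuit_deletion_iff cocircuit_def)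
    from L.circuit_diff_contraction[OF Dg this]
    have "\<exists>B. cocircuit N B \<and> e \<in> B \<and> B \<subseteq> Y \<inter> F" if "e \<in> Y \<inter> F" for e
      unfolding cocircuit_def N_def dual_minor_eq using that YD(1) by metis
    then show ?thesis by blast
  qed
  \<comment> \<open>First round: the circuits of \<open>N\<close> inside \<open>X\<close> are
    composed to one sign function orthogonal to every cocircuit of \<open>N\<close>.\<close>
  have "\<exists>v. \<forall>B\<in>{B. cocircuit N B}. orth (X \<inter> F) v B (\<tau> B)" if "X \<in> \<A>" for X
  proof -
    have "finite {A. circuit N A \<and> A \<subseteq> X \<inter> F}"
      by (rule finite_subset[of _ "Pow F"]) (use finF in auto)
    from orth_composition[OF this, of "{B. cocircuit N B}" \<sigma> "\<lambda>B. B" \<tau>]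
    show ?thesis using st covX[OF that] by simp
  qed
  then obtain v where v: "\<And>X B. X \<in> \<A> \<Longrightarrow> cocircuit N B \<Longrightarrow> orth (X \<inter> F) (v X) B (\<tau> B)"
    by (metis mem_Collect_eq)
  \<comment> \<open>Second round: the cocircuits of \<open>N\<close> inside \<open>Y\<close> are
    composed against the functions \<open>v X\<close>, now fixed, so that the two compositions are
    orthogonal to each other.\<close>
  have "\<exists>w. \<forall>X\<in>\<A>. orth (Y \<inter> F) w (X \<inter> F) (v X)" if "Y \<in> \<B>" for Y
  proof -
    have "finite {B. cocircuit N B \<and> B \<subseteq> Y \<inter> F}"
      by (rule finite_subset[of _ "Pow F"]) (use finF in auto)
    from orth_composition[OF this, of \<A> \<tau> "\<lambda>X. X \<inter> F" v]
    show ?thesis using v covY[OF that] orth_commute by (metis (no_types, lifting) mem_Collect_eq)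
  qed
  then obtain w where w: "\<And>X Y. X \<in> \<A> \<Longrightarrow> Y \<in> \<B> \<Longrightarrow> orth (Y \<inter> F) (w Y) (X \<inter> F) (v X)"
    by metis
  have "orth X (v X) Y (w Y)" if "X \<in> \<A>" "Y \<in> \<B>" for X Y
  proof -
    have "X \<inter> Y = (X \<inter> F) \<inter> (Y \<inter> F)" using that by (auto simp: F_def)
    then show ?thesis using w[OF that] orth_commute orth_cong_Int by metis
  qed
  then show ?thesis using that by blast
qed

theorem theorem3p16:
  fixes M :: "'a set_system"
  assumes "matroid M" and "tame M"
  shows "orthogonally_orientable M \<longleftrightarrow>
    (\<forall>N. minor_of N M \<and> finite (ground N) \<longrightarrow> orthogonally_orientable N)"
proof
  assume "orthogonally_orientable M"
  then show "\<forall>N. minor_of N M \<and> finite (ground N) \<longrightarrow> orthogonally_orientable N"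
    using minor_orthogonally_orientable[OF assms(1)] by blast
next
  assume minors: "\<forall>N. minor_of N M \<and> finite (ground N) \<longrightarrow> orthogonally_orientable N"
  define Q where "Q = {(X, Y). circuit M X \<and> cocircuit M Y}"
  \<comment> \<open>The unknowns are signs indexed by a set and an element. The tags
    \<open>Inl\<close> and \<open>Inr\<close> keep the signings of a set as a circuit and as a
    cocircuit apart; \<open>V\<close> collects the unknowns read by the orthogonality of one
    pair.\<close>
  define V where "V = (\<lambda>(X, Y). (\<lambda>e. (Inl X, e)) ` (X \<inter> Y) \<union> (\<lambda>e. (Inr Y, e)) ` (X \<inter> Y)
    :: (('a set + 'a set) \<times> 'a) set)"
  define sat where "sat = ((\<lambda>(X, Y) s. orth X (\<lambda>e. s (Inl X, e)) Y (\<lambda>e. s (Inr Y, e)))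
    :: 'a set \<times> 'a set \<Rightarrow> (('a set + 'a set) \<times> 'a \<Rightarrow> bool) \<Rightarrow> bool)"
  have "\<exists>s. \<forall>q\<in>Q. sat q s"
  proof (rule finite_support_compactness[of _ V])
    fix q assume "q \<in> Q"
    then show "finite (V q)" using assms(2) by (auto simp: Q_def V_def tame_def)
  next
    fix q s t assume st: "\<And>i. i \<in> V q \<Longrightarrow> s i = t i" and s: "sat q s"
    obtain X Y where q: "q = (X, Y)" by (cases q)
    have "s (Inl X, e) = t (Inl X, e)" "s (Inr Y, e) = t (Inr Y, e)" if "e \<in> X \<inter> Y" for e
      using st that by (auto simp: q V_def)
    then show "sat q t" using s unfolding q sat_def orth_def by fastforce
  next
    fix F assume F: "finite F" "F \<subseteq> Q"
    \<comment> \<open>All circuits and cocircuits occurring in \<open>F\<close> are signed at once,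
      so that even pairs outside \<open>F\<close> become orthogonal.\<close>
    obtain v w where vw: "\<And>X Y. X \<in> fst ` F \<Longrightarrow> Y \<in> snd ` F \<Longrightarrow> orth X (v X) Y (w Y)"
      by (rule finite_minor_signs[OF assms, of "fst ` F" "snd ` F"])
        (use minors F in \<open>auto simp: Q_def\<close>)
    define s where "s = (\<lambda>(Z, e). case Z of Inl X \<Rightarrow> v X e | Inr Y \<Rightarrow> w Y e)"
    have "sat q s" if "q \<in> F" for q
    proof -
      obtain X Y where q: "q = (X, Y)" by (cases q)
      then have "X \<in> fst ` F" "Y \<in> snd ` F" using that by force+
      then show ?thesis using vw by (simp add: q sat_def s_def)
    qed
    then show "\<exists>s. \<forall>q\<in>F. sat q s" by blast
  qed
  then obtain s where s: "\<forall>q\<in>Q. sat q s" by blast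
  show "orthogonally_orientable M"
    unfolding orthogonally_orientable_iff
    by (intro exI[of _ "\<lambda>X e. s (Inl X, e)"] exI[of _ "\<lambda>Y e. s (Inr Y, e)"])
      (use s in \<open>auto simp: Q_def sat_def\<close>)
qed

end
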